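(* Let $a\in\mathbb{R}$, $\alpha\in\mathbb{R}\setminus\mathbb{Z}_+$, $\lambda\in\mathbb{R}\setminus\{1\}$, and let $x:\mathbb{N}_{a+1}\to\mathbb{R}$ be such that its nabla Laplace transform converges for $|s-1|<r$, where $r>0$. Then for all $s\in\mathbb{C}$ with $|s-1|<\min\{r,|1-\lambda|\}$, $$\mathscr{N}_a\bigl\{{}_a^{\rm G}\nabla_k^{\alpha,\lambda}x(k)\bigr\}=\Bigl(\frac{s-\lambda}{1-\lambda}\Bigr)^{\alpha}\mathscr{N}_a\{x(k)\}.$$
   Context: $\mathbb{N}_{a+1}=\{a+1,a+2,\dots\}$; $\mathbb{Z}_+=\{1,2,\dots\}$. $\binom{p}{i}=\frac{p(p-1)\cdots(p-i+1)}{i!}$ for real $p$ and integer $i\ge 0$. Nabla Laplace transform of $x:\mathbb{N}_{a+1}\to\mathbb{R}$: $\mathscr{N}_a\{x(k)\}=\sum_{j=1}^{+\infty}(1-s)^{j-1}x(j+a)$, a function of $s\in\mathbb{C}$. Grünwald–Letnikov difference/sum of order $\alpha\in\mathbb{R}$: ${}_a^{\rm G}\nabla_k^\alpha z(k)=\sum_{i=0}^{k-a-1}(-1)^i\binom{\alpha}{i}z(k-i)$, $k\in\mathbb{N}_{a+1}$. Its tempered version with tempered function $w(k)=(1-\lambda)^{k-a}$ is ${}_a^{\rm G}\nabla_k^{\alpha,\lambda}x(k)=(1-\lambda)^{-(k-a)}\,{}_a^{\rm G}\nabla_k^{\alpha}\bigl[(1-\lambda)^{k-a}x(k)\bigr]$.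 Complex powers are principal values (on the stated region $\left|\frac{s-\lambda}{1-\lambda}-1\right|<1$). *)

theory Defs
  imports "HOL-Analysis.Analysis"
begin

(* A function on {a+1, a+2, ...} is represented by a total function real => real.  Every value used
   below is taken at a point of that set, as long as k is itself such a point. *)

(* The j-th summand here, j >= 0, is the (j+1)-st summand (1-s)^j x(j+1+a) of the series indexed
   from 1. *)
definition nabla_laplace_summand :: "real \<Rightarrow> (real \<Rightarrow> real) \<Rightarrow> complex \<Rightarrow> nat \<Rightarrow> complex" where
  "nabla_laplace_summand a x s j = (1 - s) ^ j * complex_of_real (x (real (Suc j) + a))"

definition nabla_laplace_converges :: "real \<Rightarrow> (real \<Rightarrow> real) \<Rightarrow> complex \<Rightarrow> bool" where
  "nabla_laplace_converges a x s \<longleftrightarrow> summable (nabla_laplace_summand a x s)"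

definition nabla_laplace :: "real \<Rightarrow> (real \<Rightarrow> real) \<Rightarrow> complex \<Rightarrow> complex" where
  "nabla_laplace a x s = (\<Sum>j. nabla_laplace_summand a x s j)"

(* k - a is a positive integer on the domain of interest, so the floor is exact there. *)
definition gl_nabla :: "real \<Rightarrow> real \<Rightarrow> (real \<Rightarrow> real) \<Rightarrow> real \<Rightarrow> real" where
  "gl_nabla a \<alpha> z k = (\<Sum>i = 0..nat \<lfloor>k - a - 1\<rfloor>. (- 1) ^ i * (\<alpha> gchoose i) * z (k - real i))"

(* 1 - lam may be negative, hence an integer power rather than powr. *)
definition tempered_fn :: "real \<Rightarrow> real \<Rightarrow> real \<Rightarrow> real" where
  "tempered_fn a lam k = (1 - lam) powi \<lfloor>k - a\<rfloor>"

definition tempered_gl_nabla :: "real \<Rightarrow> real \<Rightarrow> real \<Rightarrow> (real \<Rightarrow> real) \<Rightarrow> real \<Rightarrow> real" where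
  "tempered_gl_nabla a \<alpha> lam x k =
     inverse (tempered_fn a lam k) * gl_nabla a \<alpha> (\<lambda>t. tempered_fn a lam t * x t) k"

end

theory Submission
  imports Defs
begin

text \<open>
  In the tempered difference the factors \<open>(1 - \<lambda>)\<^sup>k\<^sup>-\<^sup>a\<close> cancel down to \<open>(1 - \<lambda>)\<^sup>-\<^sup>i\<close> in the \<open>i\<close>-th term, so
  its transform is the Cauchy product of the transform of \<open>x\<close> with the binomial series of
  \<open>(1 + u)\<^sup>\<alpha>\<close> at \<open>u = - (1 - s) / (1 - \<lambda>)\<close>, where \<open>1 + u = (s - \<lambda>) / (1 - \<lambda>)\<close>.
  Both are power series inside their discs of convergence, hence absolutely convergent.
\<close>

lemma gbinomial_of_real:
  "of_real (a gchoose n) = (of_real a gchoose n :: 'a :: {real_div_algebra, field_char_0})"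
  by (simp add: gbinomial_prod_rev)

lemma tempered_fn_at: "tempered_fn a lam (real n + a) = (1 - lam) ^ n"
  by (simp add: tempered_fn_def)

lemma tempered_gl_nabla_at:
  assumes "lam \<noteq> 1"
  shows "tempered_gl_nabla a \<alpha> lam x (real (Suc j) + a) =
    (\<Sum>i\<le>j. (\<alpha> gchoose i) * (- 1 / (1 - lam)) ^ i * x (real (Suc (j - i)) + a))"
proof -
  have "inverse ((1 - lam) ^ Suc j) * ((- 1) ^ i * (\<alpha> gchoose i) *
          (tempered_fn a lam (real (Suc j) + a - real i) * x (real (Suc j) + a - real i))) =
        (\<alpha> gchoose i) * (- 1 / (1 - lam)) ^ i * x (real (Suc (j - i)) + a)"
    if "i \<le> j" for i
  proof -
    \<comment> \<open>Since \<open>i \<le> j\<close>, the shifted argument is again a point of the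
      domain, so the floor in \<open>tempered_fn\<close> is exact and the weight there is
      \<open>(1 - lam) ^ Suc (j - i)\<close>.\<close>
    have shift: "real (Suc j) + a - real i = real (Suc (j - i)) + a"
      using that by (simp add: of_nat_diff)
    have "(1 - lam) ^ Suc j = (1 - lam) ^ i * (1 - lam) ^ Suc (j - i)"
      using that by (simp flip: power_add)
    then have "inverse ((1 - lam) ^ Suc j) * (1 - lam) ^ Suc (j - i) = (1 / (1 - lam)) ^ i"
      using assms by (simp add: field_simps)
    moreover have "(- 1 / (1 - lam)) ^ i = (- 1) ^ i * (1 / (1 - lam)) ^ i"
      by (simp flip: power_mult_distrib)
    ultimately have "(\<alpha> gchoose i) * (- 1 / (1 - lam)) ^ i =
        inverse ((1 - lam) ^ Suc j) * ((- 1) ^ i * (\<alpha> gchoose i) * (1 - lam) ^ Suc (j - i))"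
      by (simp only: mult_ac)
    then show ?thesis
      unfolding shift tempered_fn_at by (simp only: mult.assoc)
  qed
  \<comment> \<open>The point \<open>real (Suc j) + a\<close> is k, so the upper limit k - a - 1 of
    the difference is exactly \<open>j\<close>, as a Cauchy product needs.\<close>
  moreover have "nat \<lfloor>real (Suc j) + a - a - 1\<rfloor> = j"
    by simp
  ultimately show ?thesis
    unfolding tempered_gl_nabla_def gl_nabla_def tempered_fn_at sum_distrib_left atMost_atLeast0
    by (intro sum.cong) simp_all
qed

text \<open>The transform is a power series in \<open>1 - s\<close>; convergence at a point farther
  from the centre gives absolute convergence at \<open>s\<close>.\<close>

lemma summable_norm_nabla_laplace_summand:
  assumes conv: "\<And>s. cmod (s - 1) < r \<Longrightarrow> nabla_laplace_converges a x s"
    and s: "cmod (s - 1) < r"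
  shows "summable (\<lambda>j. norm (nabla_laplace_summand a x s j))"
proof -
  obtain t where t: "cmod (s - 1) < t" "t < r"
    using dense[OF s] by blast
  have "0 < t"
    using norm_ge_zero t(1) by (rule le_less_trans)
  \<comment> \<open>Evaluating the hypothesis at \<open>1 - of_real t\<close> makes the variable of
    the power series equal to \<open>t\<close>, strictly between \<open>cmod (s - 1)\<close> and
    \<open>r\<close>.\<close>
  have "summable (\<lambda>j. of_real (x (real (Suc j) + a)) * complex_of_real t ^ j)"
    using conv[of "1 - of_real t"] t \<open>0 < t\<close>
    by (simp add: nabla_laplace_converges_def nabla_laplace_summand_def[abs_def] mult.commute)
  from powser_insidea[OF this, of "1 - s"] show ?thesis
    using t \<open>0 < t\<close> by (simp add: nabla_laplace_summand_def norm_minus_commute mult.commute)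
qed

text \<open>The binomial series has radius of convergence 1, or infinity when \<open>a\<close> is a
  natural number.\<close>

lemma summable_norm_gbinomial_series:
  fixes a z :: complex
  assumes "norm z < 1"
  shows "summable (\<lambda>n. norm ((a gchoose n) * z ^ n))"
  by (rule abs_summable_in_conv_radius) (use assms in \<open>auto simp: conv_radius_gchoose\<close>)

theorem theorem12:
  fixes a \<alpha> lam r :: real and x :: "real \<Rightarrow> real"
  assumes "\<alpha> \<notin> real ` {1..}"
    and "lam \<noteq> 1"
    and "r > 0"
    and "\<And>s. cmod (s - 1) < r \<Longrightarrow> nabla_laplace_converges a x s"
  shows "\<forall>s. cmod (s - 1) < min r \<bar>1 - lam\<bar> \<longrightarrow>
           nabla_laplace_converges a (tempered_gl_nabla a \<alpha> lam x) s \<and>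
           nabla_laplace a (tempered_gl_nabla a \<alpha> lam x) s =
             ((s - complex_of_real lam) / (1 - complex_of_real lam)) powr complex_of_real \<alpha> *
             nabla_laplace a x s"
proof (intro allI impI)
  fix s
  assume s: "cmod (s - 1) < min r \<bar>1 - lam\<bar>"
  define u where "u = - (1 - s) / (1 - complex_of_real lam)"
  define b where "b i = (complex_of_real \<alpha> gchoose i) * u ^ i" for i
  have nz: "1 - complex_of_real lam \<noteq> 0"
    using \<open>lam \<noteq> 1\<close> by (metis of_real_1 of_real_eq_iff right_minus_eq)
  have "cmod (1 - complex_of_real lam) = \<bar>1 - lam\<bar>"
    by (metis norm_of_real of_real_1 of_real_diff)
  \<comment> \<open>This is the bound \<open>cmod (s - 1) < \<bar>1 - lam\<bar>\<close>. It also
    puts \<open>1 + u\<close> in the right half-plane, away from the branch cut of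
    \<open>powr\<close>.\<close>
  then have u: "norm u < 1"
    using s \<open>lam \<noteq> 1\<close> by (simp add: u_def norm_divide norm_minus_commute)
  have "1 + u = (s - complex_of_real lam) / (1 - complex_of_real lam)"
    using nz by (simp add: u_def field_simps)
  with gen_binomial_complex[OF u, of "of_real \<alpha>"]
  have binomial: "(\<Sum>i. b i) =
      ((s - complex_of_real lam) / (1 - complex_of_real lam)) powr complex_of_real \<alpha>"
    by (simp add: b_def sums_iff)
  have "nabla_laplace_summand a (tempered_gl_nabla a \<alpha> lam x) s j =
      (\<Sum>i\<le>j. b i * nabla_laplace_summand a x s (j - i))" for j
  proof -
    have "(1 - s) ^ j * complex_of_real ((\<alpha> gchoose i) * (- 1 / (1 - lam)) ^ i *
            x (real (Suc (j - i)) + a)) = b i * nabla_laplace_summand a x s (j - i)"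
      if "i \<le> j" for i
    proof -
      \<comment> \<open>Of the \<open>j\<close> factors \<open>1 - s\<close>, \<open>i\<close> go
        into \<open>u ^ i\<close> and the other \<open>j - i\<close> stay with the summand of
        \<open>x\<close>.\<close>
      have "(1 - s) ^ j = (1 - s) ^ i * (1 - s) ^ (j - i)"
        using that by (simp flip: power_add)
      moreover have "u = (1 - s) * complex_of_real (- 1 / (1 - lam))"
        using nz by (simp add: u_def field_simps)
      then have "u ^ i = (1 - s) ^ i * complex_of_real (- 1 / (1 - lam)) ^ i"
        by (simp only: power_mult_distrib)
      ultimately show ?thesis
        unfolding b_def nabla_laplace_summand_def of_real_mult of_real_power gbinomial_of_real
        by (simp only: mult_ac)
    qed
    then show ?thesis
      unfolding nabla_laplace_summand_def[of a "tempered_gl_nabla a \<alpha> lam x"]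
        tempered_gl_nabla_at[OF \<open>lam \<noteq> 1\<close>] of_real_sum sum_distrib_left
      by (intro sum.cong) simp_all
  qed
  moreover have "summable (\<lambda>i. norm (b i))"
    unfolding b_def using u by (rule summable_norm_gbinomial_series)
  moreover have "summable (\<lambda>j. norm (nabla_laplace_summand a x s j))"
    using assms(4) s by (intro summable_norm_nabla_laplace_summand[of r]) auto
  \<comment> \<open>Stated with \<open>sums\<close>, the product theorem yields both the convergence
    of the transform and its value.\<close>
  ultimately have "nabla_laplace_summand a (tempered_gl_nabla a \<alpha> lam x) s sums
      ((\<Sum>i. b i) * nabla_laplace a x s)"
    using Cauchy_product_sums[of b "nabla_laplace_summand a x s"]
    unfolding nabla_laplace_def by (simp cong: sums_cong)
  then show "nabla_laplace_converges a (tempered_gl_nabla a \<alpha> lam x) s \<and>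
           nabla_laplace a (tempered_gl_nabla a \<alpha> lam x) s =
             ((s - complex_of_real lam) / (1 - complex_of_real lam)) powr complex_of_real \<alpha> *
             nabla_laplace a x s"
    by (simp add: nabla_laplace_converges_def nabla_laplace_def[of a "tempered_gl_nabla a \<alpha> lam x"]
        sums_iff binomial)
qed

end
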